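(* For every function $f\colon\{0,1\}^n\to\{0,1\}$ and every probability distribution $\mu$ over $\{0,1\}^n$, $$\max_{S\in\mathcal{O}_n}\mathsf{bias}(f,\mu,S)\;\le\;\max_{S\in\mathcal{S}_n}\mathsf{bias}(f,\mu,S)\;\le\;\|\widehat{F_\mu}\|_\infty\;\le\;2\cdot\max_{S\in\mathcal{O}_n}\mathsf{bias}(f,\mu,S).$$
   Context: $n\ge 1$. $\mathcal{S}_n$ is the set of all affine subspaces of $\{0,1\}^n=\mathbb{F}_2^n$ and $\mathcal{O}_n\subseteq\mathcal{S}_n$ is the set of affine subspaces of codimension $1$. $\mathsf{bias}(f,\mu,S)=\left|\sum_{x\in S}(-1)^{f(x)}\mu(x)\right|$. $F_\mu\colon\{0,1\}^n\to\mathbb{R}$ is $F_\mu(x)=(-1)^{f(x)}\cdot\mu(x)\cdot 2^n$. The Fourier transform of $F\colon\{0,1\}^n\to\mathbb{R}$ is $\widehat F(z)=2^{-n}\sum_{x\in\{0,1\}^n}F(x)(-1)^{\langle x,z\rangle}$ with $\langle x,z\rangle=\sum_i x_iz_i\bmod 2$, and $\|\widehat F\|_\infty=\max_{z}|\widehat F(z)|$. *)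

theory Defs
  imports
    "HOL-Analysis.Cartesian_Space"
    "HOL-Library.Z2"
    "HOL-Probability.Probability_Mass_Function"
begin

text \<open>
  The cube \<open>{0,1}\<^sup>n\<close> is the vector space \<open>bit ^ 'n\<close> over the two-element field \<open>bit\<close>, where
  \<open>n = CARD('n)\<close>; since types are nonempty, \<open>n \<ge> 1\<close> holds automatically.
\<close>

instance bit :: finite
proof
  have "(UNIV :: bit set) \<subseteq> {0, 1}"
    by auto
  then show "finite (UNIV :: bit set)"
    by (rule finite_subset) simp
qed

text \<open>Affine subspaces are translates of linear subspaces; in particular, they are nonempty.\<close>

definition affine_subspaces :: "(bit ^ 'n) set set"
  where "affine_subspaces = {(\<lambda>v. a + v) ` V | a V. vec.subspace V}"

definition affine_subspaces_codim1 :: "(bit ^ 'n) set set"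
  where "affine_subspaces_codim1 =
    {(\<lambda>v. a + v) ` V | a V. vec.subspace V \<and> vec.dim V + 1 = CARD('n)}"

definition bit_sign :: "bit \<Rightarrow> real"
  where "bit_sign b = (- 1) ^ (of_bit b :: nat)"

definition bias :: "(bit ^ 'n \<Rightarrow> bit) \<Rightarrow> (bit ^ 'n) pmf \<Rightarrow> (bit ^ 'n) set \<Rightarrow> real"
  where "bias f \<mu> S = \<bar>\<Sum>x\<in>S. bit_sign (f x) * pmf \<mu> x\<bar>"

definition weighted_sign :: "(bit ^ 'n \<Rightarrow> bit) \<Rightarrow> (bit ^ 'n) pmf \<Rightarrow> bit ^ 'n \<Rightarrow> real"
  where "weighted_sign f \<mu> x = bit_sign (f x) * pmf \<mu> x * 2 ^ CARD('n)"

text \<open>The sum is taken in \<open>bit\<close>, that is, modulo 2.\<close>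

definition bit_inner :: "bit ^ 'n \<Rightarrow> bit ^ 'n \<Rightarrow> bit"
  where "bit_inner x z = (\<Sum>i\<in>UNIV. x $ i * z $ i)"

definition fourier :: "(bit ^ 'n \<Rightarrow> real) \<Rightarrow> bit ^ 'n \<Rightarrow> real"
  where "fourier F z = (\<Sum>x\<in>UNIV. F x * bit_sign (bit_inner x z)) / 2 ^ CARD('n)"

definition sup_norm :: "(bit ^ 'n \<Rightarrow> real) \<Rightarrow> real"
  where "sup_norm G = Max (range (\<lambda>z. \<bar>G z\<bar>))"

text \<open>
  \<open>Max\<close> is only meaningful on finite nonempty sets. All sets of sets here are finite because
  \<open>bit ^ 'n\<close> is a finite type; the following facts show nonemptiness.
\<close>

lemma affine_subspaces_codim1_subset:
  "affine_subspaces_codim1 \<subseteq> (affine_subspaces :: (bit ^ 'n) set set)"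
  by (auto simp: affine_subspaces_codim1_def affine_subspaces_def)

lemma affine_subspaces_codim1_nonempty:
  "(affine_subspaces_codim1 :: (bit ^ 'n) set set) \<noteq> {}"
proof -
  obtain b :: "bit ^ 'n" where b: "b \<in> cart_basis"
    by (auto simp: cart_basis_def)
  let ?B = "cart_basis - {b}"
  have "vec.independent ?B"
    using independent_cart_basis by (rule vec.independent_mono) auto
  then have "vec.dim (vec.span ?B) = card ?B"
    by (simp add: vec.dim_eq_card_independent)
  also have "card ?B + 1 = CARD('n)"
    using b card_cart_basis[where 'a = bit and 'i = 'n] finite_cart_basis
      card_Suc_Diff1[of "cart_basis :: (bit ^ 'n) set" b] by simp
  finally have dim: "vec.dim (vec.span ?B) + 1 = CARD('n)"
    by simp
  have "(\<lambda>v. 0 + v) ` vec.span ?B \<in> affine_subspaces_codim1"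
    unfolding affine_subspaces_codim1_def using vec.subspace_span[of ?B] dim by blast
  then show ?thesis
    by blast
qed

end

theory Submission
  imports Defs
begin

text \<open>
  The factors \<open>2\<^sup>n\<close> cancel, so the Fourier coefficient of \<open>F\<^sub>\<mu>\<close> at \<open>z\<close> is the correlation of the
  signed measure \<open>g x = (-1)\<^bsup>f x\<^esup> \<mu> x\<close> with the character of \<open>z\<close>. The indicator of an affine
  subspace \<open>a + V\<close> is the average of the translated characters of the annihilator of \<open>V\<close>, so the
  \<open>g\<close>-sum over \<open>a + V\<close> is a signed average of Fourier coefficients. Conversely, a Fourier
  coefficient splits over the two cosets of a hyperplane, on each of which the character is
  constant, so the bias of one of them is at least half the absolute value of the coefficient.
\<close>

lemma bit_sign_diff: "bit_sign (b - c) = bit_sign b * bit_sign c"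
  by (cases b; cases c) (auto simp: bit_sign_def)

lemma bit_sign_add: "bit_sign (b + c) = bit_sign b * bit_sign c"
  by (cases b; cases c) (auto simp: bit_sign_def)

lemma bit_sign_0 [simp]: "bit_sign 0 = 1"
  and bit_sign_1 [simp]: "bit_sign 1 = - 1"
  by (auto simp: bit_sign_def)

lemma abs_bit_sign [simp]: "\<bar>bit_sign b\<bar> = 1"
  by (cases b) auto

lemma bit_inner_add_left: "bit_inner (x + y) z = bit_inner x z + bit_inner y z"
  by (simp only: bit_inner_def vector_add_component distrib_right sum.distrib)

lemma bit_inner_add_right: "bit_inner x (y + z) = bit_inner x y + bit_inner x z"
  by (simp only: bit_inner_def vector_add_component distrib_left sum.distrib)

lemma bit_inner_diff_left: "bit_inner (x - y) z = bit_inner x z - bit_inner y z"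
  by (simp only: bit_inner_def vector_minus_component left_diff_distrib sum_subtractf)

lemma bit_inner_scale_left: "bit_inner (c *s x) z = c * bit_inner x z"
  by (simp only: bit_inner_def vector_smult_component sum_distrib_left mult.assoc)

lemma bit_inner_zero_left [simp]: "bit_inner 0 z = 0"
  and bit_inner_zero_right [simp]: "bit_inner x 0 = 0"
  by (simp_all add: bit_inner_def)

text \<open>A nonzero entry over \<open>bit\<close> is 1, so the unit vector at that coordinate
  works.\<close>

lemma exists_bit_inner_eq_1:
  fixes z :: "bit ^ 'n"
  assumes "z \<noteq> 0"
  obtains x where "bit_inner x z = 1"
proof -
  from assms obtain i where i: "z $ i \<noteq> 0"
    by (auto simp: vec_eq_iff)
  have "bit_inner (axis i 1) z = (\<Sum>j\<in>UNIV. if j = i then z $ j else 0)"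
    unfolding bit_inner_def by (intro sum.cong) (auto simp: axis_def)
  also have "\<dots> = 1"
    using i by simp
  finally show thesis
    by (rule that)
qed

text \<open>Since \<open>y\<close> is independent of a basis of \<open>V\<close>, some linear map
  kills that basis and takes \<open>y\<close> to the all-ones vector. Each row of its matrix
  represents a functional that separates \<open>y\<close> from \<open>V\<close>.\<close>

lemma separating_bit_inner:
  fixes V :: "(bit ^ 'n) set"
  assumes V: "vec.subspace V" and y: "y \<notin> V"
  obtains w where "\<And>v. v \<in> V \<Longrightarrow> bit_inner v w = 0" "bit_inner y w = 1"
proof -
  obtain B where B: "B \<subseteq> V" "vec.independent B" "V \<subseteq> vec.span B"
    using vec.basis_exists by metis
  have span: "vec.span B = V"
    using B V vec.span_minimal by blast
  have "vec.independent (insert y B)"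
    using B y span by (simp add: vec.independent_insert)
  then obtain g :: "bit ^ 'n \<Rightarrow> bit ^ 'n" where
    g: "Vector_Spaces.linear (*s) (*s) g"
    "\<And>x. x \<in> insert y B \<Longrightarrow> g x = (if x = y then 1 else 0)"
    using vec.linear_independent_extend[of "insert y B" "\<lambda>x. if x = y then 1 else 0"] by blast
  \<comment> \<open>Any coordinate serves, since every entry of \<open>1 :: bit ^ 'n\<close> is
    1.\<close>
  fix k :: 'n
  have row: "bit_inner x (matrix g $ k) = g x $ k" for x
  proof -
    have "g x $ k = (matrix g *v x) $ k"
      using matrix_works[OF g(1)] by simp
    then show ?thesis
      by (simp only: matrix_vector_mult_def bit_inner_def vec_lambda_beta mult.commute)
  qed
  have zero: "g x = 0" if "x \<in> B" for x
    using g(2)[of x] that y B(1) by auto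
  have "g v = 0" if "v \<in> V" for v
    using vec.linear_eq_0_on_span[OF g(1) zero] that span by blast
  moreover have "g y = 1"
    using g(2) by simp
  ultimately show thesis
    using that[of "matrix g $ k"] row by simp
qed

text \<open>Both level sets are translates of the kernel of a nonzero functional, and the kernel
  spans the whole space once a single outside vector \<open>y\<close> is added.\<close>

lemma hyperplane_codim1:
  fixes z :: "bit ^ 'n"
  assumes "z \<noteq> 0"
  shows "{x. bit_inner x z = b} \<in> affine_subspaces_codim1"
proof -
  let ?H = "{x. bit_inner x z = 0}"
  have H: "vec.subspace ?H"
    by (auto simp: vec.subspace_def bit_inner_add_left bit_inner_scale_left)
  obtain y where y: "bit_inner y z = 1"
    using assms by (rule exists_bit_inner_eq_1)
  have coset: "{x. bit_inner x z = bit_inner a z} = (\<lambda>v. a + v) ` ?H" for a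
  proof (intro set_eqI iffI)
    fix x assume "x \<in> {x. bit_inner x z = bit_inner a z}"
    then have "x - a \<in> ?H"
      by (simp add: bit_inner_diff_left)
    then show "x \<in> (\<lambda>v. a + v) ` ?H"
      by (rule rev_image_eqI) simp
  qed (auto simp: bit_inner_add_left)
  have "x \<in> vec.span (insert y ?H)" for x
  proof (cases "bit_inner x z")
    case zero
    then show ?thesis by (auto intro: vec.span_base)
  next
    case one
    with y coset[of y] obtain v where "v \<in> ?H" "x = y + v" by auto
    then show ?thesis by (auto intro: vec.span_add vec.span_base)
  qed
  then have "vec.span (insert y ?H) = UNIV"
    by blast
  then have "vec.dim (insert y ?H) = CARD('n)"
    by (metis vec.dim_span vec_dim_card)
  moreover have "y \<notin> vec.span ?H"
    unfolding vec.span_eq_iff[THEN iffD2, OF H] using y by simp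
  ultimately have dim: "vec.dim ?H + 1 = CARD('n)"
    by (simp add: vec.dim_insert)
  \<comment> \<open>Both values are attained: 0 at the origin and 1 at \<open>y\<close>.\<close>
  obtain a where "b = bit_inner a z"
  proof (cases b)
    case zero
    then show thesis using that[of 0] by simp
  next
    case one
    then show thesis using that[of y] y by simp
  qed
  then show ?thesis
    unfolding affine_subspaces_codim1_def using H dim coset[of a] by blast
qed

text \<open>Translation by \<open>w\<close> permutes \<open>W\<close> and flips the sign of every
  term, so the sum equals its own negative.\<close>

lemma sum_characters_eq_0:
  fixes W :: "(bit ^ 'n) set"
  assumes W: "\<And>z. z \<in> W \<Longrightarrow> z + w \<in> W" and w: "bit_inner y w = 1"
  shows "(\<Sum>z\<in>W. bit_sign (bit_inner y z)) = 0"
proof -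
  \<comment> \<open>In characteristic 2 the translation is its own inverse, so it is the witness in
    both directions of the reindexing.\<close>
  have ww: "z + w + w = z" for z
    by (simp add: vec_eq_iff add.assoc)
  have "(\<Sum>z\<in>W. bit_sign (bit_inner y z)) = (\<Sum>z\<in>W. bit_sign (bit_inner y (z + w)))"
    by (rule sum.reindex_bij_witness[of _ "\<lambda>z. z + w" "\<lambda>z. z + w"]) (auto simp: ww W)
  also have "\<dots> = - (\<Sum>z\<in>W. bit_sign (bit_inner y z))"
    by (simp only: bit_inner_add_right bit_sign_add w bit_sign_1 mult_minus_right mult_1_right
        sum_negf)
  finally show ?thesis
    by simp
qed

lemma fourier_weighted_sign:
  "fourier (weighted_sign f \<mu>) z =
    (\<Sum>x\<in>UNIV. bit_sign (f x) * pmf \<mu> x * bit_sign (bit_inner x z))"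
  by (simp add: fourier_def weighted_sign_def sum_divide_distrib mult_ac)

lemma abs_le_sup_norm: "\<bar>G z\<bar> \<le> sup_norm G"
  unfolding sup_norm_def by (intro Max_ge) auto

lemma bias_le_sup_norm_fourier:
  fixes f :: "bit ^ 'n \<Rightarrow> bit"
  assumes "S \<in> affine_subspaces"
  shows "bias f \<mu> S \<le> sup_norm (fourier (weighted_sign f \<mu>))"
proof -
  obtain a V where V: "vec.subspace V" and S: "S = (\<lambda>v. a + v) ` V"
    using assms by (auto simp: affine_subspaces_def)
  define g where "g x = bit_sign (f x) * pmf \<mu> x" for x
  define M where "M = sup_norm (fourier (weighted_sign f \<mu>))"
  \<comment> \<open>The annihilator of \<open>V\<close>. It contains 0, so the factor
    \<open>card W\<close> is positive and can be cancelled at the end.\<close>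
  define W where "W = {z. \<forall>v\<in>V. bit_inner v z = 0}"
  have "0 \<in> W"
    by (simp add: W_def)
  then have card: "card W > 0"
    by (auto simp: card_gt_0_iff)
  \<comment> \<open>On \<open>S\<close> every term is 1. Off \<open>S\<close>, a functional in
    \<open>W\<close> that separates \<open>x - a\<close> from \<open>V\<close> makes the terms
    cancel.\<close>
  have indicator: "(\<Sum>z\<in>W. bit_sign (bit_inner (x - a) z)) = (if x \<in> S then card W else 0)" for x
  proof (cases "x - a \<in> V")
    case True
    then have "x \<in> S"
      unfolding S by (rule rev_image_eqI) simp
    with True show ?thesis
      by (simp add: W_def)
  next
    case False
    then have "x \<notin> S"
      by (auto simp: S)
    obtain w where w: "\<And>v. v \<in> V \<Longrightarrow> bit_inner v w = 0" "bit_inner (x - a) w = 1"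
      using separating_bit_inner[OF V False] by blast
    have "(\<Sum>z\<in>W. bit_sign (bit_inner (x - a) z)) = 0"
      using w by (intro sum_characters_eq_0[of _ w]) (auto simp: W_def bit_inner_add_right)
    with \<open>x \<notin> S\<close> show ?thesis
      by simp
  qed
  have "card W * (\<Sum>x\<in>S. g x) = (\<Sum>x\<in>UNIV. g x * (if x \<in> S then card W else 0))"
    by (simp add: sum_distrib_left sum_distrib_right if_distrib sum.If_cases mult.commute cong: if_cong)
  also have "\<dots> = (\<Sum>x\<in>UNIV. \<Sum>z\<in>W. g x * bit_sign (bit_inner (x - a) z))"
    by (simp only: indicator[symmetric] sum_distrib_left)
  also have "\<dots> = (\<Sum>z\<in>W. \<Sum>x\<in>UNIV. g x * bit_sign (bit_inner (x - a) z))"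
    by (rule sum.swap)
  \<comment> \<open>The shift by \<open>a\<close> contributes only a sign, which the absolute value
    removes in the final estimate.\<close>
  also have "\<dots> = (\<Sum>z\<in>W. bit_sign (bit_inner a z) * fourier (weighted_sign f \<mu>) z)"
    by (simp only: fourier_weighted_sign g_def bit_inner_diff_left bit_sign_diff
        sum_distrib_left mult_ac)
  finally have "card W * \<bar>\<Sum>x\<in>S. g x\<bar> =
      \<bar>\<Sum>z\<in>W. bit_sign (bit_inner a z) * fourier (weighted_sign f \<mu>) z\<bar>"
    by (metis abs_mult abs_of_nat)
  also have "\<dots> \<le> (\<Sum>z\<in>W. M)"
    by (intro order_trans[OF sum_abs] sum_mono) (simp add: abs_mult M_def abs_le_sup_norm)
  finally have "card W * \<bar>\<Sum>x\<in>S. g x\<bar> \<le> card W * M"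
    by simp
  then show ?thesis
    using card by (simp add: bias_def g_def M_def)
qed

lemma abs_fourier_le_bias:
  fixes f :: "bit ^ 'n \<Rightarrow> bit"
  assumes bound: "\<And>S. S \<in> affine_subspaces_codim1 \<Longrightarrow> bias f \<mu> S \<le> m"
  shows "\<bar>fourier (weighted_sign f \<mu>) z\<bar> \<le> 2 * m"
proof -
  \<comment> \<open>The trivial character is constant on every hyperplane, so for \<open>z = 0\<close> any \<open>w\<close> will do.\<close>
  obtain w where w: "w \<noteq> 0" and zw: "z = 0 \<or> w = z"
    by (metis zero_neq_one)
  let ?g = "\<lambda>x. bit_sign (f x) * pmf \<mu> x"
  let ?H = "\<lambda>b. {x. bit_inner x w = b}"
  have coset: "\<bar>\<Sum>x\<in>?H b. ?g x * bit_sign (bit_inner x z)\<bar> \<le> m" for b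
  proof -
    \<comment> \<open>The constant is 0 if \<open>z = 0\<close> and \<open>b\<close> if
      \<open>w = z\<close>. The character then changes at most the sign of the sum over the
      coset.\<close>
    obtain c where "\<And>x. x \<in> ?H b \<Longrightarrow> bit_inner x z = c"
      using zw by fastforce
    then have "(\<Sum>x\<in>?H b. ?g x * bit_sign (bit_inner x z)) = (\<Sum>x\<in>?H b. ?g x) * bit_sign c"
      by (simp add: sum_distrib_right)
    then show ?thesis
      using bound[OF hyperplane_codim1[OF w, of b]] by (simp add: bias_def abs_mult)
  qed
  have "?H 0 \<union> ?H 1 = UNIV"
    by (auto intro: bit.exhaust)
  then have "fourier (weighted_sign f \<mu>) z =
      (\<Sum>x\<in>?H 0 \<union> ?H 1. ?g x * bit_sign (bit_inner x z))"
    by (simp add: fourier_weighted_sign)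
  also have "\<dots> = (\<Sum>x\<in>?H 0. ?g x * bit_sign (bit_inner x z)) +
      (\<Sum>x\<in>?H 1. ?g x * bit_sign (bit_inner x z))"
    by (rule sum.union_disjoint) auto
  \<comment> \<open>Each of the two cosets contributes at most \<open>m\<close> in absolute value,
    whence the factor 2.\<close>
  finally show ?thesis
    using coset[of 0] coset[of 1] by linarith
qed

theorem lemma8:
  fixes f :: "bit ^ 'n \<Rightarrow> bit" and \<mu> :: "(bit ^ 'n) pmf"
  shows "Max (bias f \<mu> ` affine_subspaces_codim1) \<le> Max (bias f \<mu> ` affine_subspaces) \<and>
    Max (bias f \<mu> ` affine_subspaces) \<le> sup_norm (fourier (weighted_sign f \<mu>)) \<and>
    sup_norm (fourier (weighted_sign f \<mu>)) \<le> 2 * Max (bias f \<mu> ` affine_subspaces_codim1)"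
proof (intro conjI)
  note subset = affine_subspaces_codim1_subset and nonempty = affine_subspaces_codim1_nonempty
  show "Max (bias f \<mu> ` affine_subspaces_codim1) \<le> Max (bias f \<mu> ` affine_subspaces)"
    using subset nonempty by (intro Max_mono image_mono) auto
  have "affine_subspaces \<noteq> ({} :: (bit ^ 'n) set set)"
    using subset nonempty by blast
  then show "Max (bias f \<mu> ` affine_subspaces) \<le> sup_norm (fourier (weighted_sign f \<mu>))"
    by (intro Max.boundedI) (auto intro: bias_le_sup_norm_fourier)
  have "\<bar>fourier (weighted_sign f \<mu>) z\<bar> \<le> 2 * Max (bias f \<mu> ` affine_subspaces_codim1)" for z
    by (rule abs_fourier_le_bias) (auto intro: Max_ge)
  then show "sup_norm (fourier (weighted_sign f \<mu>)) \<le> 2 * Max (bias f \<mu> ` affine_subspaces_codim1)"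
    unfolding sup_norm_def by (intro Max.boundedI) auto
qed

end
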